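(* Let $q$ be an odd positive integer and let $G$ be a group. Then $G\otimes^q G\cong \nabla^q(G)\times (G\wedge^q G)$.
   Context: Notation: ${}^g h=ghg^{-1}$ and $[g,h]=ghg^{-1}h^{-1}$. For $q\geq 1$, the $q$-tensor square $G\otimes^q G$ is the group generated by symbols $g\otimes h$ and $\{(g,g)\}$ ($g,h\in G$) subject to the following relations for all $g,h,g_1,h_1\in G$: (1) $gg_1\otimes h=({}^g g_1\otimes {}^g h)(g\otimes h)$; (2) $g\otimes hh_1=(g\otimes h)({}^h g\otimes {}^h h_1)$; (3) $\{(g,g)\}(g_1\otimes h_1)\{(g,g)\}^{-1}={}^{g^q}g_1\otimes {}^{g^q}h_1$; (4) $\{(gg_1,gg_1)\}=\{(g,g)\}\prod_{i=1}^{q-1}\big(g^{-1}\otimes({}^{g^{1-q+i}}g_1)^i\big)\{(g_1,g_1)\}$ (product in increasing order of $i$); (5) $[\{(g,g)\},\{(g_1,g_1)\}]=g^q\otimes g_1^q$; (6) $\{([g,h],[g,h])\}=(g\otimes h)^q$. $\nabla^q(G)$ is the normal subgroup of $G\otimes^q G$ generated by all $g\otimes g$, $g\in G$, and $G\wedge^q G=(G\otimes^q G)/\nabla^q(G)$. *)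

theory Defs
  imports "HOL-Algebra.Coset"
begin

section \<open>Groups given by generators and relations\<close>

text \<open>
  A letter is a generator together with a sign: \<open>(x, True)\<close> stands for \<open>x\<close> and
  \<open>(x, False)\<close> for its formal inverse.  A relation \<open>u = v\<close> is a pair \<open>(u, v)\<close> of words.
\<close>

type_synonym 'x word = "('x \<times> bool) list"

definition words :: "'x set \<Rightarrow> 'x word set"
  where "words X = lists (X \<times> UNIV)"

definition word_inv :: "'x word \<Rightarrow> 'x word"
  where "word_inv w = rev (map (\<lambda>(x, b). (x, \<not> b)) w)"

inductive pres_eq :: "'x set \<Rightarrow> 'x word rel \<Rightarrow> 'x word \<Rightarrow> 'x word \<Rightarrow> bool"
  for X R
  where
    refl: "w \<in> words X \<Longrightarrow> pres_eq X R w w"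
  | sym: "pres_eq X R u v \<Longrightarrow> pres_eq X R v u"
  | trans: "pres_eq X R u v \<Longrightarrow> pres_eq X R v w \<Longrightarrow> pres_eq X R u w"
  | cancel: "u \<in> words X \<Longrightarrow> v \<in> words X \<Longrightarrow> x \<in> X
      \<Longrightarrow> pres_eq X R (u @ [(x, b), (x, \<not> b)] @ v) (u @ v)"
  | rel: "(r, s) \<in> R \<Longrightarrow> r \<in> words X \<Longrightarrow> s \<in> words X \<Longrightarrow> u \<in> words X \<Longrightarrow> v \<in> words X
      \<Longrightarrow> pres_eq X R (u @ r @ v) (u @ s @ v)"

definition pres_rel :: "'x set \<Rightarrow> 'x word rel \<Rightarrow> 'x word rel"
  where "pres_rel X R = {(u, v). pres_eq X R u v}"

definition pres_class :: "'x set \<Rightarrow> 'x word rel \<Rightarrow> 'x word \<Rightarrow> 'x word set"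
  where "pres_class X R w = pres_rel X R `` {w}"

definition presented_group :: "'x set \<Rightarrow> 'x word rel \<Rightarrow> 'x word set monoid"
  where "presented_group X R =
    \<lparr>carrier = words X // pres_rel X R,
     mult = (\<lambda>A B. \<Union>a\<in>A. \<Union>b\<in>B. pres_class X R (a @ b)),
     one = pres_class X R []\<rparr>"

lemma words_simps [simp]:
  "[] \<in> words X"
  "(l # w \<in> words X) = (fst l \<in> X \<and> w \<in> words X)"
  "(u @ v \<in> words X) = (u \<in> words X \<and> v \<in> words X)"
  by (auto simp: words_def mem_Times_iff)

lemma word_inv_simps [simp]:
  "word_inv [] = []"
  "word_inv ((x, b) # w) = word_inv w @ [(x, \<not> b)]"
  by (auto simp: word_inv_def)

lemma word_inv_words [simp]: "w \<in> words X \<Longrightarrow> word_inv w \<in> words X"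
  by (auto simp: word_inv_def words_def)

lemma pres_eq_words: "pres_eq X R u v \<Longrightarrow> u \<in> words X \<and> v \<in> words X"
  by (induction rule: pres_eq.induct) auto

lemma equiv_pres_rel: "equiv (words X) (pres_rel X R)"
proof (rule equivI)
  show "pres_rel X R \<subseteq> words X \<times> words X"
    by (auto simp: pres_rel_def dest: pres_eq_words)
  show "refl_on (words X) (pres_rel X R)"
    by (auto simp: pres_rel_def refl_on_def intro: pres_eq.refl)
  show "sym_on UNIV (pres_rel X R)"
    by (auto simp: pres_rel_def sym_on_def intro: pres_eq.sym)
  show "trans_on UNIV (pres_rel X R)"
    unfolding pres_rel_def trans_on_def by (blast intro: pres_eq.trans)
qed

lemma pres_eq_context:
  "pres_eq X R u v \<Longrightarrow> a \<in> words X \<Longrightarrow> b \<in> words X \<Longrightarrow> pres_eq X R (a @ u @ b) (a @ v @ b)"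
proof (induction rule: pres_eq.induct)
  case (cancel u v x c)
  then show ?case using pres_eq.cancel[of "a @ u" X "v @ b" x R c] by simp
next
  case (rel r s u v)
  then show ?case using pres_eq.rel[of r s R X "a @ u" "v @ b"] by simp
next
  case (trans u v w)
  then show ?case by (blast intro: pres_eq.trans)
next
  case (refl w)
  then show ?case by (simp add: pres_eq.refl)
next
  case (sym u v)
  then show ?case by (simp add: pres_eq.sym)
qed

lemma pres_eq_append:
  assumes "pres_eq X R u u'" "pres_eq X R v v'"
  shows "pres_eq X R (u @ v) (u' @ v')"
proof (rule pres_eq.trans)
  show "pres_eq X R (u @ v) (u' @ v)"
    using pres_eq_context[OF assms(1), of "[]" v] pres_eq_words[OF assms(2)] by simp
  show "pres_eq X R (u' @ v) (u' @ v')"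
    using pres_eq_context[OF assms(2), of u' "[]"] pres_eq_words[OF assms(1)] by simp
qed

lemma pres_eq_word_inv: "w \<in> words X \<Longrightarrow> pres_eq X R (word_inv w @ w) []"
proof (induction w)
  case Nil
  then show ?case by (simp add: pres_eq.refl)
next
  case (Cons l w)
  obtain x b where l: "l = (x, b)" by (cases l)
  have "pres_eq X R (word_inv w @ [(x, \<not> b), (x, \<not> \<not> b)] @ w) (word_inv w @ w)"
    using Cons.prems l by (intro pres_eq.cancel) auto
  moreover have "pres_eq X R (word_inv w @ w) []"
    using Cons by simp
  ultimately have "pres_eq X R (word_inv w @ [(x, \<not> b), (x, \<not> \<not> b)] @ w) []"
    by (rule pres_eq.trans)
  then show ?case
    using l by simp
qed

lemma pres_class_eq_iff:
  assumes "u \<in> words X" "v \<in> words X"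
  shows "pres_class X R u = pres_class X R v \<longleftrightarrow> pres_eq X R u v"
  using eq_equiv_class_iff[OF equiv_pres_rel assms] by (simp add: pres_class_def pres_rel_def)

lemma presented_group_carrier: "carrier (presented_group X R) = pres_class X R ` words X"
  by (auto simp: presented_group_def quotient_def pres_class_def)

lemma presented_group_one: "\<one>\<^bsub>presented_group X R\<^esub> = pres_class X R []"
  by (simp add: presented_group_def)

lemma presented_group_mult:
  assumes "u \<in> words X" "v \<in> words X"
  shows "pres_class X R u \<otimes>\<^bsub>presented_group X R\<^esub> pres_class X R v = pres_class X R (u @ v)"
proof -
  have *: "pres_class X R (a @ b) = pres_class X R (u @ v)"
    if "a \<in> pres_class X R u" "b \<in> pres_class X R v" for a b
  proof -
    have "pres_eq X R u a" "pres_eq X R v b"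
      using that by (auto simp: pres_class_def pres_rel_def)
    then have "pres_eq X R (u @ v) (a @ b)"
      by (rule pres_eq_append)
    then show ?thesis
      using pres_class_eq_iff[of "u @ v" X "a @ b" R] pres_eq_words by fastforce
  qed
  have "u \<in> pres_class X R u" "v \<in> pres_class X R v"
    using assms by (auto simp: pres_class_def pres_rel_def intro: pres_eq.refl)
  then have "(\<Union>a\<in>pres_class X R u. \<Union>b\<in>pres_class X R v. pres_class X R (a @ b))
      = pres_class X R (u @ v)"
    using * by blast
  then show ?thesis
    by (simp add: presented_group_def)
qed

lemma group_presented_group: "group (presented_group X R)"
proof (rule groupI)
  fix A assume "A \<in> carrier (presented_group X R)"
  then obtain w where w: "w \<in> words X" "A = pres_class X R w"
    by (auto simp: presented_group_carrier)
  have "pres_class X R (word_inv w) \<otimes>\<^bsub>presented_group X R\<^esub> A = \<one>\<^bsub>presented_group X R\<^esub>"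
    using w pres_eq_word_inv[OF w(1), of R]
    by (simp add: presented_group_mult presented_group_one pres_class_eq_iff)
  then show "\<exists>B\<in>carrier (presented_group X R). B \<otimes>\<^bsub>presented_group X R\<^esub> A = \<one>\<^bsub>presented_group X R\<^esub>"
    using w by (auto simp: presented_group_carrier)
qed (auto simp: presented_group_carrier presented_group_mult presented_group_one)


section \<open>The q-tensor square\<close>

definition normal_closure :: "('a, 'b) monoid_scheme \<Rightarrow> 'a set \<Rightarrow> 'a set"
  where "normal_closure G S = \<Inter>{N. N \<lhd> G \<and> S \<subseteq> N}"

definition conjugate :: "('a, 'b) monoid_scheme \<Rightarrow> 'a \<Rightarrow> 'a \<Rightarrow> 'a"
  where "conjugate G g h = g \<otimes>\<^bsub>G\<^esub> h \<otimes>\<^bsub>G\<^esub> inv\<^bsub>G\<^esub> g"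

definition commutator :: "('a, 'b) monoid_scheme \<Rightarrow> 'a \<Rightarrow> 'a \<Rightarrow> 'a"
  where "commutator G g h = g \<otimes>\<^bsub>G\<^esub> h \<otimes>\<^bsub>G\<^esub> inv\<^bsub>G\<^esub> g \<otimes>\<^bsub>G\<^esub> inv\<^bsub>G\<^esub> h"

text \<open>\<open>Tensor g h\<close> is the symbol \<open>g \<otimes> h\<close> and \<open>Diag g\<close> is the symbol \<open>{(g,g)}\<close>.\<close>

datatype 'a symb = Tensor 'a 'a | Diag 'a

definition symbs :: "('a, 'b) monoid_scheme \<Rightarrow> 'a symb set"
  where "symbs G = {Tensor g h |g h. g \<in> carrier G \<and> h \<in> carrier G} \<union> Diag ` carrier G"

abbreviation tens :: "'a \<Rightarrow> 'a \<Rightarrow> 'a symb word"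
  where "tens g h \<equiv> [(Tensor g h, True)]"

abbreviation diag :: "'a \<Rightarrow> 'a symb word"
  where "diag g \<equiv> [(Diag g, True)]"

inductive_set q_tensor_rels :: "nat \<Rightarrow> ('a, 'b) monoid_scheme \<Rightarrow> 'a symb word rel"
  for q :: nat and G :: "('a, 'b) monoid_scheme" (structure)
  where
    tensor_mult_left: "\<lbrakk>g \<in> carrier G; g1 \<in> carrier G; h \<in> carrier G\<rbrakk> \<Longrightarrow>
      (tens (g \<otimes> g1) h, tens (conjugate G g g1) (conjugate G g h) @ tens g h) \<in> q_tensor_rels q G"
  | tensor_mult_right: "\<lbrakk>g \<in> carrier G; h \<in> carrier G; h1 \<in> carrier G\<rbrakk> \<Longrightarrow>
      (tens g (h \<otimes> h1), tens g h @ tens (conjugate G h g) (conjugate G h h1)) \<in> q_tensor_rels q G"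
  | diag_conj: "\<lbrakk>g \<in> carrier G; g1 \<in> carrier G; h1 \<in> carrier G\<rbrakk> \<Longrightarrow>
      (diag g @ tens g1 h1 @ word_inv (diag g),
       tens (conjugate G (g [^] q) g1) (conjugate G (g [^] q) h1)) \<in> q_tensor_rels q G"
  | diag_mult: "\<lbrakk>g \<in> carrier G; g1 \<in> carrier G\<rbrakk> \<Longrightarrow>
      (diag (g \<otimes> g1),
       diag g
       @ concat (map (\<lambda>i. tens (inv g) (conjugate G (g [^] (1 - int q + int i)) g1 [^] i)) [1..<q])
       @ diag g1) \<in> q_tensor_rels q G"
  | diag_commutator: "\<lbrakk>g \<in> carrier G; g1 \<in> carrier G\<rbrakk> \<Longrightarrow>
      (diag g @ diag g1 @ word_inv (diag g) @ word_inv (diag g1),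
       tens (g [^] q) (g1 [^] q)) \<in> q_tensor_rels q G"
  | commutator_diag: "\<lbrakk>g \<in> carrier G; h \<in> carrier G\<rbrakk> \<Longrightarrow>
      (diag (commutator G g h), concat (replicate q (tens g h))) \<in> q_tensor_rels q G"

definition q_tensor_square :: "nat \<Rightarrow> ('a, 'b) monoid_scheme \<Rightarrow> 'a symb word set monoid"
  where "q_tensor_square q G = presented_group (symbs G) (q_tensor_rels q G)"

definition q_tensor :: "nat \<Rightarrow> ('a, 'b) monoid_scheme \<Rightarrow> 'a \<Rightarrow> 'a \<Rightarrow> 'a symb word set"
  where "q_tensor q G g h = pres_class (symbs G) (q_tensor_rels q G) (tens g h)"

definition nabla :: "nat \<Rightarrow> ('a, 'b) monoid_scheme \<Rightarrow> 'a symb word set set"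
  where "nabla q G = normal_closure (q_tensor_square q G) {q_tensor q G g g |g. g \<in> carrier G}"

definition nabla_group :: "nat \<Rightarrow> ('a, 'b) monoid_scheme \<Rightarrow> 'a symb word set monoid"
  where "nabla_group q G = (q_tensor_square q G)\<lparr>carrier := nabla q G\<rparr>"

definition q_exterior_square :: "nat \<Rightarrow> ('a, 'b) monoid_scheme \<Rightarrow> 'a symb word set set monoid"
  where "q_exterior_square q G = q_tensor_square q G Mod nabla q G"

text \<open>
  The side conditions \<open>r, s \<in> words X\<close> in the definition of \<open>pres_eq\<close> discard nothing here.
\<close>

lemma q_tensor_rels_words:
  assumes "group G"
  shows "q_tensor_rels q G \<subseteq> words (symbs G) \<times> words (symbs G)"
proof -
  interpret group G by fact
  have conj: "conjugate G a b \<in> carrier G" if "a \<in> carrier G" "b \<in> carrier G" for a b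
    using that by (simp add: conjugate_def)
  have "r \<in> words (symbs G) \<and> s \<in> words (symbs G)" if "(r, s) \<in> q_tensor_rels q G" for r s
    using that
    by (cases rule: q_tensor_rels.cases)
      (auto intro!: conj simp: words_def in_lists_conv_set word_inv_def symbs_def commutator_def)
  then show ?thesis by auto
qed

lemma normal_normal_closure:
  assumes "group G" "S \<subseteq> carrier G"
  shows "normal_closure G S \<lhd> G"
proof -
  interpret group G by fact
  have "carrier G \<lhd> G"
    by (simp add: normal_inv_iff subgroup_self)
  then have ne: "{N. N \<lhd> G \<and> S \<subseteq> N} \<noteq> {}" using assms(2) by blast
  have "subgroup (normal_closure G S) G"
    unfolding normal_closure_def using ne
    by (intro subgroups_Inter) (auto intro: normal_imp_subgroup)
  then show ?thesis
    by (auto simp: normal_inv_iff normal_closure_def)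
qed

lemma nabla_normal: "nabla q G \<lhd> q_tensor_square q G"
  unfolding nabla_def
proof (rule normal_normal_closure)
  show "group (q_tensor_square q G)"
    by (simp add: q_tensor_square_def group_presented_group)
  show "{q_tensor q G g g |g. g \<in> carrier G} \<subseteq> carrier (q_tensor_square q G)"
    by (auto simp: q_tensor_def q_tensor_square_def presented_group_carrier symbs_def)
qed

end

theory Submission
  imports Defs
begin

text \<open>
  Write \<open>T\<close> for the \<open>q\<close>-tensor square, \<open>N\<close> for the normal closure of the squares \<open>g \<otimes> g\<close>, and
  \<open>q = 2m - 1\<close>.  A normal subgroup \<open>N\<close> onto which the whole group retracts is a direct factor
  with complement isomorphic to the quotient: \<open>x \<mapsto> (\<rho> x, N x)\<close> is an isomorphism
  (\<open>retract_is_direct_factor\<close>).  So the theorem amounts to a retraction \<open>\<rho>: T \<rightarrow> N\<close>, and for odd \<open>q\<close>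
  one is obtained by averaging a tensor with its mirror image,
  \<open>\<rho>(g \<otimes> h) = ((g \<otimes> h)(h \<otimes> g))\<^sup>m\<close> and \<open>\<rho>{(g,g)} = 1\<close> (\<open>nabla_retraction\<close>).

  Three facts make this work.  First, \<open>N\<close> is central in \<open>T\<close> and \<open>z\<^sup>q = 1\<close> for all \<open>z\<close> in \<open>N\<close>
  (\<open>nabla_central_exponent\<close>), so raising to the power \<open>m\<close> is a square root on \<open>N\<close>; in particular
  \<open>\<rho>(g \<otimes> g) = (g \<otimes> g)\<^sup>2\<^sup>m = g \<otimes> g\<close>.  Centrality comes from expanding a product tensor in
  two ways, the exponent from the last defining relation at a trivial commutator.  Second,
  \<open>(g \<otimes> h)(h \<otimes> g)\<close> is the polarization of \<open>g \<mapsto> g \<otimes> g\<close>, so it lies in \<open>N\<close>, and it is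
  multiplicative in both arguments (\<open>polarization\<close>, \<open>sym_mult_left\<close>).  Third, every map that is
  multiplicative in both arguments, with values of exponent \<open>q\<close> in an abelian group, extends to
  \<open>T\<close> by sending all \<open>{(g,g)}\<close> to \<open>1\<close> (\<open>bimultiplicative_extends_to_q_tensor_square\<close>).
\<close>

section \<open>Homomorphisms out of a presented group\<close>

primrec word_value :: "('c, 'd) monoid_scheme \<Rightarrow> ('x \<Rightarrow> 'c) \<Rightarrow> 'x word \<Rightarrow> 'c" where
  "word_value K f [] = \<one>\<^bsub>K\<^esub>"
| "word_value K f (l # w) =
    (if snd l then f (fst l) else inv\<^bsub>K\<^esub> f (fst l)) \<otimes>\<^bsub>K\<^esub> word_value K f w"

context group
begin

lemma word_value_closed [simp, intro]:
  "f \<in> X \<rightarrow> carrier G \<Longrightarrow> w \<in> words X \<Longrightarrow> word_value G f w \<in> carrier G"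
  by (induction w) (auto simp: Pi_iff)

lemma word_value_append:
  "f \<in> X \<rightarrow> carrier G \<Longrightarrow> u \<in> words X \<Longrightarrow> v \<in> words X
    \<Longrightarrow> word_value G f (u @ v) = word_value G f u \<otimes> word_value G f v"
  by (induction u) (auto simp: Pi_iff m_assoc)

lemma word_value_pres_eq:
  assumes f: "f \<in> X \<rightarrow> carrier G"
    and R: "\<And>r s. (r, s) \<in> R \<Longrightarrow> word_value G f r = word_value G f s"
    and "pres_eq X R u v"
  shows "word_value G f u = word_value G f v"
  using assms(3)
proof (induction rule: pres_eq.induct)
  case (cancel u v x b)
  have "f x \<in> carrier G" using f cancel by auto
  then have "word_value G f ([(x, b), (x, \<not> b)] @ v) = word_value G f v"
    using f cancel by (cases b) (auto simp: m_assoc[symmetric])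
  then show ?case
    using f cancel by (simp add: word_value_append del: append_Cons append_Nil)
next
  case (rel r s u v)
  then show ?case using f R[of r s] by (simp add: word_value_append)
qed auto

text \<open>
  The universal property: an assignment on the generators under which both sides of each relation
  have the same value induces a homomorphism.
\<close>

lemma presented_group_hom:
  assumes f: "f \<in> X \<rightarrow> carrier G"
    and R: "\<And>r s. (r, s) \<in> R \<Longrightarrow> word_value G f r = word_value G f s"
  obtains \<phi> where "\<phi> \<in> hom (presented_group X R) G"
    and "\<And>w. w \<in> words X \<Longrightarrow> \<phi> (pres_class X R w) = word_value G f w"
proof
  define \<phi> where
    "\<phi> A = word_value G f (SOME w. w \<in> words X \<and> pres_class X R w = A)" for A
  show \<phi>: "\<phi> (pres_class X R w) = word_value G f w" if "w \<in> words X" for w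
  proof -
    let ?v = "SOME v. v \<in> words X \<and> pres_class X R v = pres_class X R w"
    have "?v \<in> words X \<and> pres_class X R ?v = pres_class X R w"
      by (rule someI[of _ w]) (use that in simp)
    then have eq: "pres_eq X R ?v w"
      using that pres_class_eq_iff by blast
    show ?thesis
      unfolding \<phi>_def by (rule word_value_pres_eq[OF f _ eq]) (rule R)
  qed
  show "\<phi> \<in> hom (presented_group X R) G"
    by (rule homI)
      (auto simp: presented_group_carrier presented_group_mult \<phi> word_value_closed[OF f]
        word_value_append[OF f])
qed

end

lemma (in group) inv_commute:
  assumes "x \<otimes> y = y \<otimes> x" and [simp]: "x \<in> carrier G" "y \<in> carrier G"
  shows "inv x \<otimes> y = y \<otimes> inv x"
  using assms(1) by (metis assms(2,3) inv_closed inv_solve_left inv_solve_right m_assoc m_closed)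

text \<open>
  Centrality needs to be tested on generators only, since the elements commuting with \<open>z\<close> are closed
  under products and inverses.
\<close>

lemma presented_group_centralI:
  fixes X R
  defines "P \<equiv> presented_group X R"
  assumes z: "z \<in> carrier P"
    and gen: "\<And>x. x \<in> X
      \<Longrightarrow> z \<otimes>\<^bsub>P\<^esub> pres_class X R [(x, True)] = pres_class X R [(x, True)] \<otimes>\<^bsub>P\<^esub> z"
    and c: "c \<in> carrier P"
  shows "z \<otimes>\<^bsub>P\<^esub> c = c \<otimes>\<^bsub>P\<^esub> z"
proof -
  interpret P: group P unfolding P_def by (rule group_presented_group)
  have cl: "pres_class X R w \<in> carrier P" if "w \<in> words X" for w
    using that by (auto simp: P_def presented_group_carrier)
  have letter: "z \<otimes>\<^bsub>P\<^esub> pres_class X R [(x, b)] = pres_class X R [(x, b)] \<otimes>\<^bsub>P\<^esub> z"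
    if "x \<in> X" for x b
  proof (cases b)
    case False
    let ?y = "pres_class X R [(x, True)]" and ?y' = "pres_class X R [(x, False)]"
    have y: "?y \<in> carrier P" "?y' \<in> carrier P" using that by (auto intro: cl)
    have "?y' \<otimes>\<^bsub>P\<^esub> ?y = \<one>\<^bsub>P\<^esub>"
      using that pres_eq_word_inv[of "[(x, True)]" X R]
      by (simp add: P_def presented_group_mult presented_group_one pres_class_eq_iff)
    then have "?y' = inv\<^bsub>P\<^esub> ?y" using y by (metis P.inv_equality)
    moreover have "z \<otimes>\<^bsub>P\<^esub> inv\<^bsub>P\<^esub> ?y = inv\<^bsub>P\<^esub> ?y \<otimes>\<^bsub>P\<^esub> z"
      using P.inv_commute[of ?y z] gen[OF that] y z by simp
    ultimately show ?thesis using False by simp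
  qed (use gen that in simp)
  have "z \<otimes>\<^bsub>P\<^esub> pres_class X R w = pres_class X R w \<otimes>\<^bsub>P\<^esub> z" if "w \<in> words X" for w
    using that
  proof (induction w)
    case Nil
    have "pres_class X R [] = \<one>\<^bsub>P\<^esub>" by (simp add: P_def presented_group_one)
    then show ?case using z by simp
  next
    case (Cons l w)
    obtain x b where l: "l = (x, b)" by (cases l)
    have x: "x \<in> X" and w: "w \<in> words X" using Cons.prems l by auto
    let ?l = "pres_class X R [(x, b)]" and ?w = "pres_class X R w"
    have split: "pres_class X R (l # w) = ?l \<otimes>\<^bsub>P\<^esub> ?w"
      using presented_group_mult[of "[(x, b)]" X w R] x w l by (simp add: P_def)
    have cls: "?l \<in> carrier P" "?w \<in> carrier P" using x w by (auto intro: cl)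
    show ?case unfolding split
      using letter[OF x, of b] Cons.IH[OF w] cls z by (metis P.m_assoc)
  qed
  then show ?thesis using c by (auto simp: P_def presented_group_carrier)
qed

section \<open>Crossed pairings\<close>

context group
begin

lemma conjugate_closed [simp, intro]:
  "g \<in> carrier G \<Longrightarrow> h \<in> carrier G \<Longrightarrow> conjugate G g h \<in> carrier G"
  by (simp add: conjugate_def)

lemma conjugate_one_right [simp]: "g \<in> carrier G \<Longrightarrow> conjugate G g \<one> = \<one>"
  by (simp add: conjugate_def)

lemma conjugate_self [simp]: "g \<in> carrier G \<Longrightarrow> conjugate G g g = g"
  by (simp add: conjugate_def m_assoc)

lemma conjugate_mult:
  "g \<in> carrier G \<Longrightarrow> h \<in> carrier G \<Longrightarrow> k \<in> carrier G
    \<Longrightarrow> conjugate G g (h \<otimes> k) = conjugate G g h \<otimes> conjugate G g k"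
  by (simp add: conjugate_def m_assoc inv_solve_left)

lemma conjugate_conjugate:
  "g \<in> carrier G \<Longrightarrow> h \<in> carrier G \<Longrightarrow> k \<in> carrier G
    \<Longrightarrow> conjugate G g (conjugate G h k) = conjugate G (g \<otimes> h) k"
  by (simp add: conjugate_def m_assoc inv_mult_group)

lemma conjugate_mult_self:
  "g \<in> carrier G \<Longrightarrow> h \<in> carrier G \<Longrightarrow> conjugate G g h \<otimes> g = g \<otimes> h"
  by (simp add: conjugate_def m_assoc)

lemma conjugate_inv_cancel:
  "g \<in> carrier G \<Longrightarrow> h \<in> carrier G \<Longrightarrow> conjugate G g (conjugate G (inv g) h) = h"
  by (simp add: conjugate_def m_assoc) (simp add: m_assoc[symmetric])

end

text \<open>
  The first two defining relations of the tensor square, for values in an arbitrary group: the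
  crossed pairings \<open>G \<times> G \<rightarrow> T\<close> of Brown and Loday, for \<open>G\<close> acting on itself by conjugation.
\<close>

locale crossed_pairing = G: group G + T: group T
  for G :: "('a, 'b) monoid_scheme" (structure) and T :: "('c, 'd) monoid_scheme" +
  fixes t :: "'a \<Rightarrow> 'a \<Rightarrow> 'c"
  assumes closed [simp, intro]: "\<lbrakk>g \<in> carrier G; h \<in> carrier G\<rbrakk> \<Longrightarrow> t g h \<in> carrier T"
    and mult_left: "\<lbrakk>g \<in> carrier G; g1 \<in> carrier G; h \<in> carrier G\<rbrakk>
      \<Longrightarrow> t (g \<otimes> g1) h = t (conjugate G g g1) (conjugate G g h) \<otimes>\<^bsub>T\<^esub> t g h"
    and mult_right: "\<lbrakk>g \<in> carrier G; h \<in> carrier G; h1 \<in> carrier G\<rbrakk>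
      \<Longrightarrow> t g (h \<otimes> h1) = t g h \<otimes>\<^bsub>T\<^esub> t (conjugate G h g) (conjugate G h h1)"
begin

lemma one_one [simp]: "t \<one> \<one> = \<one>\<^bsub>T\<^esub>"
proof -
  have "t \<one> \<one> \<otimes>\<^bsub>T\<^esub> t \<one> \<one> = t \<one> \<one>"
    using mult_left[of \<one> \<one> \<one>] by simp
  then show ?thesis by (metis G.one_closed T.l_cancel_one closed)
qed

text \<open>
  The two ways of expanding \<open>t (g x) (h y)\<close>, left factor first or right factor first, agree in their
  outer factors; cancelling these leaves the identity below.
\<close>

lemma interchange:
  assumes [simp]: "g \<in> carrier G" "h \<in> carrier G" "x \<in> carrier G" "y \<in> carrier G"
  shows "t (conjugate G (g \<otimes> h) x) (conjugate G (g \<otimes> h) y) \<otimes>\<^bsub>T\<^esub> t g h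
    = t g h \<otimes>\<^bsub>T\<^esub> t (conjugate G (h \<otimes> g) x) (conjugate G (h \<otimes> g) y)"
proof -
  let ?A = "t (conjugate G g x) (conjugate G g h)"
  let ?L = "t (conjugate G (g \<otimes> h) x) (conjugate G (g \<otimes> h) y)"
  let ?R = "t (conjugate G (h \<otimes> g) x) (conjugate G (h \<otimes> g) y)"
  let ?C = "t (conjugate G h g) (conjugate G h y)"
  have "t (g \<otimes> x) (h \<otimes> y)
      = t (conjugate G g x) (conjugate G g h \<otimes> conjugate G g y) \<otimes>\<^bsub>T\<^esub> t g (h \<otimes> y)"
    by (simp add: mult_left G.conjugate_mult)
  also have "\<dots> = (?A \<otimes>\<^bsub>T\<^esub> ?L) \<otimes>\<^bsub>T\<^esub> (t g h \<otimes>\<^bsub>T\<^esub> ?C)"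
    by (simp add: mult_right G.conjugate_conjugate G.conjugate_mult_self)
  finally have 1: "t (g \<otimes> x) (h \<otimes> y) = ?A \<otimes>\<^bsub>T\<^esub> ((?L \<otimes>\<^bsub>T\<^esub> t g h) \<otimes>\<^bsub>T\<^esub> ?C)"
    by (simp add: T.m_assoc)
  have "t (g \<otimes> x) (h \<otimes> y)
      = t (g \<otimes> x) h \<otimes>\<^bsub>T\<^esub> t (conjugate G h g \<otimes> conjugate G h x) (conjugate G h y)"
    by (simp add: mult_right G.conjugate_mult)
  also have "\<dots> = (?A \<otimes>\<^bsub>T\<^esub> t g h) \<otimes>\<^bsub>T\<^esub> (?R \<otimes>\<^bsub>T\<^esub> ?C)"
    by (simp add: mult_left G.conjugate_conjugate G.conjugate_mult_self)
  finally have 2: "t (g \<otimes> x) (h \<otimes> y) = ?A \<otimes>\<^bsub>T\<^esub> ((t g h \<otimes>\<^bsub>T\<^esub> ?R) \<otimes>\<^bsub>T\<^esub> ?C)"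
    by (simp add: T.m_assoc)
  show ?thesis
    using 1 2 by simp
qed

text \<open>
  For \<open>g = h\<close> the two conjugators in the interchange identity coincide, and \<open>x\<close>, \<open>y\<close> may be replaced
  by their preimages under this conjugation.
\<close>

lemma diagonal_commute:
  assumes [simp]: "g \<in> carrier G" "x \<in> carrier G" "y \<in> carrier G"
  shows "t g g \<otimes>\<^bsub>T\<^esub> t x y = t x y \<otimes>\<^bsub>T\<^esub> t g g"
  using interchange[of g g "conjugate G (inv (g \<otimes> g)) x" "conjugate G (inv (g \<otimes> g)) y"]
  by (simp add: G.conjugate_inv_cancel)

text \<open>
  With \<open>h\<close> such that \<open>k\<close> is its conjugate by \<open>g\<close>, one has \<open>g h = k g\<close>; the claim compares the
  expansions of \<open>t g\<close> on these two factorizations.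
\<close>

lemma diagonal_conjugate:
  assumes [simp]: "g \<in> carrier G" "k \<in> carrier G"
  shows "t (conjugate G k g) (conjugate G k g) = t g g"
proof -
  define h where "h = conjugate G (inv g) k"
  have [simp]: "h \<in> carrier G" by (simp add: h_def)
  have k: "conjugate G g h = k" by (simp add: h_def G.conjugate_inv_cancel)
  have "t g k \<otimes>\<^bsub>T\<^esub> t g g = t g (g \<otimes> h)"
    by (simp add: mult_right k diagonal_commute[of g g k])
  also have "\<dots> = t g (k \<otimes> g)"
    using G.conjugate_mult_self[of g h] by (simp add: k)
  also have "\<dots> = t g k \<otimes>\<^bsub>T\<^esub> t (conjugate G k g) (conjugate G k g)"
    by (simp add: mult_right)
  finally show ?thesis by simp
qed

definition sym :: "'a \<Rightarrow> 'a \<Rightarrow> 'c" where "sym g h = t g h \<otimes>\<^bsub>T\<^esub> t h g"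

lemma sym_closed [simp, intro]: "g \<in> carrier G \<Longrightarrow> h \<in> carrier G \<Longrightarrow> sym g h \<in> carrier T"
  by (simp add: sym_def)

text \<open>
  This exhibits \<open>sym\<close> as the deviation of \<open>g \<mapsto> t g g\<close> from multiplicativity, through which \<open>sym\<close>
  inherits the commutation and the conjugation invariance of the diagonal elements.  The expansion
  starts from \<open>g h = h k\<close> with \<open>k\<close> the conjugate of \<open>g\<close> by \<open>h\<^sup>-\<^sup>1\<close>, so that the mixed
  terms come out as \<open>t g h\<close> and \<open>t h g\<close> without conjugates.
\<close>

lemma polarization:
  assumes [simp]: "g \<in> carrier G" "h \<in> carrier G"
  shows "t (g \<otimes> h) (g \<otimes> h) = (t g g \<otimes>\<^bsub>T\<^esub> t h h) \<otimes>\<^bsub>T\<^esub> sym g h"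
proof -
  define k where "k = conjugate G (inv h) g"
  have [simp]: "k \<in> carrier G" by (simp add: k_def)
  have g: "conjugate G h k = g" by (simp add: k_def G.conjugate_inv_cancel)
  have gh: "g \<otimes> h = h \<otimes> k" using G.conjugate_mult_self[of h k] by (simp add: g)
  have "t (h \<otimes> k) (h \<otimes> k) = t g (h \<otimes> g) \<otimes>\<^bsub>T\<^esub> t h (h \<otimes> k)"
    by (simp add: mult_left G.conjugate_mult g)
  also have "\<dots> = (t g h \<otimes>\<^bsub>T\<^esub> t g g) \<otimes>\<^bsub>T\<^esub> (t h h \<otimes>\<^bsub>T\<^esub> t h g)"
    by (simp add: mult_right g diagonal_conjugate)
  also have "\<dots> = (t g g \<otimes>\<^bsub>T\<^esub> t g h) \<otimes>\<^bsub>T\<^esub> (t h h \<otimes>\<^bsub>T\<^esub> t h g)"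
    by (simp add: diagonal_commute[of g g h])
  also have "\<dots> = t g g \<otimes>\<^bsub>T\<^esub> ((t h h \<otimes>\<^bsub>T\<^esub> t g h) \<otimes>\<^bsub>T\<^esub> t h g)"
    using diagonal_commute[of h g h] by (simp add: T.m_assoc[symmetric])
  finally show ?thesis
    by (simp add: gh sym_def T.m_assoc)
qed

lemma sym_commute:
  assumes [simp]: "g \<in> carrier G" "h \<in> carrier G" "x \<in> carrier G" "y \<in> carrier G"
  shows "sym g h \<otimes>\<^bsub>T\<^esub> t x y = t x y \<otimes>\<^bsub>T\<^esub> sym g h"
proof -
  let ?d = "t g g \<otimes>\<^bsub>T\<^esub> t h h"
  have d: "?d \<otimes>\<^bsub>T\<^esub> t x y = t x y \<otimes>\<^bsub>T\<^esub> ?d"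
    using diagonal_commute[of g x y] diagonal_commute[of h x y]
    by (metis T.m_assoc assms closed)
  have "?d \<otimes>\<^bsub>T\<^esub> (sym g h \<otimes>\<^bsub>T\<^esub> t x y) = t (g \<otimes> h) (g \<otimes> h) \<otimes>\<^bsub>T\<^esub> t x y"
    by (simp add: polarization T.m_assoc)
  also have "\<dots> = (t x y \<otimes>\<^bsub>T\<^esub> ?d) \<otimes>\<^bsub>T\<^esub> sym g h"
    by (subst diagonal_commute) (simp_all add: polarization T.m_assoc)
  also have "\<dots> = ?d \<otimes>\<^bsub>T\<^esub> (t x y \<otimes>\<^bsub>T\<^esub> sym g h)"
    by (simp add: d[symmetric] T.m_assoc)
  finally show ?thesis by simp
qed

lemma sym_conjugate:
  assumes [simp]: "g \<in> carrier G" "h \<in> carrier G" "k \<in> carrier G"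
  shows "sym (conjugate G k g) (conjugate G k h) = sym g h"
proof -
  have "t (conjugate G k g \<otimes> conjugate G k h) (conjugate G k g \<otimes> conjugate G k h)
      = t (g \<otimes> h) (g \<otimes> h)"
    by (simp add: diagonal_conjugate flip: G.conjugate_mult)
  then show ?thesis
    by (simp add: polarization diagonal_conjugate)
qed

lemma sym_symmetric:
  assumes [simp]: "g \<in> carrier G" "h \<in> carrier G"
  shows "sym g h = sym h g"
proof -
  have "sym g h \<otimes>\<^bsub>T\<^esub> t g h = (t g h \<otimes>\<^bsub>T\<^esub> sym h g)"
    by (simp add: sym_def T.m_assoc)
  then show ?thesis by (simp add: sym_commute)
qed

text \<open>
  The conjugated copies of \<open>t g1 h\<close> and \<open>t h g1\<close> surround \<open>sym g h\<close>, which commutes past one of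
  them; conjugation invariance of \<open>sym\<close> then removes the conjugations.
\<close>

lemma sym_mult_left:
  assumes [simp]: "g \<in> carrier G" "g1 \<in> carrier G" "h \<in> carrier G"
  shows "sym (g \<otimes> g1) h = sym g h \<otimes>\<^bsub>T\<^esub> sym g1 h"
proof -
  let ?u = "conjugate G g g1" and ?v = "conjugate G g h"
  have "sym (g \<otimes> g1) h = (t ?u ?v \<otimes>\<^bsub>T\<^esub> sym g h) \<otimes>\<^bsub>T\<^esub> t ?v ?u"
    by (simp add: sym_def mult_left mult_right T.m_assoc)
  also have "\<dots> = sym g h \<otimes>\<^bsub>T\<^esub> sym ?u ?v"
    by (simp add: sym_def[of ?u] flip: sym_commute) (simp add: T.m_assoc)
  finally show ?thesis by (simp add: sym_conjugate)
qed

lemma sym_mult_right: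
  "\<lbrakk>g \<in> carrier G; h \<in> carrier G; h1 \<in> carrier G\<rbrakk>
    \<Longrightarrow> sym g (h \<otimes> h1) = sym g h \<otimes>\<^bsub>T\<^esub> sym g h1"
  using sym_mult_left[of h h1 g] by (simp add: sym_symmetric[of g])

end

section \<open>Bimultiplicative maps extend to the tensor square\<close>

context comm_group
begin

text \<open>
  Evaluates the product in the relation for \<open>{(g g1, g g1)}\<close>, whose \<open>i\<close>-th factor has the value
  \<open>c\<^sup>i\<close> under a bimultiplicative map.
\<close>

lemma word_value_weighted_concat:
  assumes c: "c \<in> carrier G"
    and w: "\<And>i. i \<in> set l \<Longrightarrow> word_value G f (w i) = c [^] (i :: nat)"
    and X: "f \<in> X \<rightarrow> carrier G" "\<And>i. i \<in> set l \<Longrightarrow> w i \<in> words X"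
  shows "word_value G f (concat (map w l)) = c [^] sum_list l"
  using w X(2)
proof (induction l)
  case (Cons i l)
  have "concat (map w l) \<in> words X"
    using Cons.prems(2) by (auto simp: words_def in_lists_conv_set)
  then show ?case
    using Cons X(1) c by (simp add: word_value_append[OF X(1)] nat_pow_mult)
qed simp

end

lemma sum_list_upt_dvd:
  fixes q :: nat
  assumes "odd q"
  shows "q dvd sum_list [1..<q]"
proof -
  have "2 * sum_list [1..<n] = n * (n - 1)" for n :: nat
  proof (induction n)
    case (Suc n)
    then show ?case by (cases n) simp_all
  qed simp
  from this[of q] have double: "2 * sum_list [1..<q] = q * (q - 1)" .
  obtain k where k: "q = 2 * k + 1" using assms by (rule oddE)
  have "2 * sum_list [1..<q] = 2 * (q * k)"
    unfolding double by (subst (2) k) simp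
  then have "sum_list [1..<q] = q * k" by (rule mult_left_cancel[THEN iffD1, rotated]) simp
  then show ?thesis by (rule dvdI)
qed

lemma (in group) hom_conjugate_comm_group:
  assumes K: "comm_group K" and f: "f \<in> hom G K" and [simp]: "x \<in> carrier G" "g \<in> carrier G"
  shows "f (conjugate G x g) = f g"
proof -
  interpret K: comm_group K by fact
  interpret f: group_hom G K f by unfold_locales (rule f)
  show ?thesis
    by (simp add: conjugate_def K.m_comm[of "f x"] K.m_assoc)
qed

text \<open>
  Multiplicative maps into an abelian group ignore conjugation, so the two product relations and
  the conjugation relation hold.  With all \<open>{(g,g)}\<close> sent to \<open>1\<close>, both commutator relations hold
  because the values have exponent \<open>q\<close>.  The relation for \<open>{(g g1, g g1)}\<close> requires that
  \<open>b (g\<^sup>-\<^sup>1) g1\<close> raised to the power \<open>1 + \<dots> + (q - 1) = q (q - 1) / 2\<close> be trivial; for odd \<open>q\<close>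
  this number is a multiple of \<open>q\<close>.
\<close>

lemma (in group) bimultiplicative_extends_to_q_tensor_square:
  assumes K: "comm_group K" and q: "odd q"
    and left: "\<And>h. h \<in> carrier G \<Longrightarrow> (\<lambda>g. b g h) \<in> hom G K"
    and right: "\<And>g. g \<in> carrier G \<Longrightarrow> (\<lambda>h. b g h) \<in> hom G K"
    and exponent: "\<And>g h. g \<in> carrier G \<Longrightarrow> h \<in> carrier G \<Longrightarrow> b g h [^]\<^bsub>K\<^esub> q = \<one>\<^bsub>K\<^esub>"
  obtains \<phi> where "\<phi> \<in> hom (q_tensor_square q G) K"
    and "\<And>g h. g \<in> carrier G \<Longrightarrow> h \<in> carrier G \<Longrightarrow> \<phi> (q_tensor q G g h) = b g h"
proof -
  interpret K: comm_group K by fact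
  define f where "f s = (case s of Tensor g h \<Rightarrow> b g h | Diag g \<Rightarrow> \<one>\<^bsub>K\<^esub>)" for s
  have f_simps [simp]: "f (Tensor g h) = b g h" "f (Diag g) = \<one>\<^bsub>K\<^esub>" for g h
    by (simp_all add: f_def)
  have b [simp, intro]: "b g h \<in> carrier K" if "g \<in> carrier G" "h \<in> carrier G" for g h
    using left[of h] that by (auto simp: hom_def)
  have f: "f \<in> symbs G \<rightarrow> carrier K"
    by (auto simp: symbs_def)
  have b_left: "b (g \<otimes> g1) h = b g h \<otimes>\<^bsub>K\<^esub> b g1 h"
    if "g \<in> carrier G" "g1 \<in> carrier G" "h \<in> carrier G" for g g1 h
    using left[of h] that by (auto simp: hom_def)
  have b_right: "b g (h \<otimes> h1) = b g h \<otimes>\<^bsub>K\<^esub> b g h1"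
    if "g \<in> carrier G" "h \<in> carrier G" "h1 \<in> carrier G" for g h h1
    using right[of g] that by (auto simp: hom_def)
  have b_conj_left [simp]: "b (conjugate G x g) h = b g h"
    if "x \<in> carrier G" "g \<in> carrier G" "h \<in> carrier G" for x g h
    using hom_conjugate_comm_group[OF K left] that by blast
  have b_conj_right [simp]: "b g (conjugate G x h) = b g h"
    if "x \<in> carrier G" "g \<in> carrier G" "h \<in> carrier G" for x g h
    using hom_conjugate_comm_group[OF K right] that by blast
  have b_pow: "b g (h [^] (n :: nat)) = b g h [^]\<^bsub>K\<^esub> n"
    if "g \<in> carrier G" "h \<in> carrier G" for g h n
  proof -
    interpret group_hom G K "\<lambda>h. b g h" by unfold_locales (rule right[OF that(1)])
    show ?thesis using hom_nat_pow[OF that(2)] .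
  qed
  have pow_q: "c [^]\<^bsub>K\<^esub> n = \<one>\<^bsub>K\<^esub>"
    if "c \<in> carrier K" "c [^]\<^bsub>K\<^esub> q = \<one>\<^bsub>K\<^esub>" "q dvd n" for c and n :: nat
    using that by (auto simp: K.nat_pow_pow[symmetric])
  have replicate: "word_value K f (replicate n (Tensor g h, True)) = b g h [^]\<^bsub>K\<^esub> n"
    if "g \<in> carrier G" "h \<in> carrier G" for g h n
    using that by (induction n) (auto simp: K.m_comm)
  have "word_value K f r = word_value K f s" if "(r, s) \<in> q_tensor_rels q G" for r s
    using that
  proof cases
    case (tensor_mult_left g g1 h)
    then show ?thesis by (simp add: b_left K.m_comm)
  next
    case (tensor_mult_right g h h1)
    then show ?thesis by (simp add: b_right)
  next
    case (diag_conj g g1 h1)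
    then show ?thesis by simp
  next
    case (diag_mult g g1)
    let ?u = "\<lambda>i. conjugate G (g [^] (1 - int q + int i)) g1 [^] i"
    let ?w = "concat (map (\<lambda>i. tens (inv g) (?u i)) [1..<q])"
    note [simp] = diag_mult(3,4)
    have w: "?w \<in> words (symbs G)"
      by (auto simp: words_def in_lists_conv_set symbs_def)
    have "word_value K f ?w = b (inv g) g1 [^]\<^bsub>K\<^esub> sum_list [1..<q]"
      by (rule K.word_value_weighted_concat[OF _ _ f]) (auto simp: b_pow symbs_def)
    also have "\<dots> = \<one>\<^bsub>K\<^esub>"
      by (rule pow_q[OF _ _ sum_list_upt_dvd[OF q]]) (simp_all add: exponent)
    finally show ?thesis
      using w by (simp add: diag_mult(1,2) K.word_value_append[OF f] symbs_def)
  next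
    case (diag_commutator g g1)
    then show ?thesis by (simp add: b_pow exponent)
  next
    case (commutator_diag g h)
    then show ?thesis by (simp add: replicate exponent)
  qed
  from K.presented_group_hom[OF f this] obtain \<phi>
    where hom: "\<phi> \<in> hom (presented_group (symbs G) (q_tensor_rels q G)) K"
      and val: "\<And>w. w \<in> words (symbs G)
        \<Longrightarrow> \<phi> (pres_class (symbs G) (q_tensor_rels q G) w) = word_value K f w"
    by blast
  show ?thesis
  proof (rule that[of \<phi>])
    show "\<phi> \<in> hom (q_tensor_square q G) K" using hom by (simp add: q_tensor_square_def)
    show "\<phi> (q_tensor q G g h) = b g h" if "g \<in> carrier G" "h \<in> carrier G" for g h
      using val[of "tens g h"] that by (simp add: q_tensor_def symbs_def)
  qed
qed

section \<open>The diagonal part of the tensor square\<close>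

context group
begin

lemma group_q_tensor_square: "group (q_tensor_square q G)"
  by (simp add: q_tensor_square_def group_presented_group)

lemma crossed_pairing_q_tensor: "crossed_pairing G (q_tensor_square q G) (q_tensor q G)"
proof -
  let ?X = "symbs G" and ?R = "q_tensor_rels q G"
  have rel: "pres_class ?X ?R r = pres_class ?X ?R s" if "(r, s) \<in> ?R" for r s
  proof -
    have "r \<in> words ?X" "s \<in> words ?X" using q_tensor_rels_words[of G q] that is_group by auto
    then show ?thesis
      using pres_eq.rel[OF that, of ?X "[]" "[]"] by (simp add: pres_class_eq_iff)
  qed
  have tens: "tens g h \<in> words ?X" if "g \<in> carrier G" "h \<in> carrier G" for g h
    using that by (simp add: symbs_def)
  show ?thesis
  proof (intro crossed_pairing.intro crossed_pairing_axioms.intro)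
    show "group G" by (rule is_group)
    show "group (q_tensor_square q G)" by (rule group_q_tensor_square)
    show "q_tensor q G g h \<in> carrier (q_tensor_square q G)"
      if "g \<in> carrier G" "h \<in> carrier G" for g h
      using tens that by (auto simp: q_tensor_def q_tensor_square_def presented_group_carrier)
    show "q_tensor q G (g \<otimes> g1) h = q_tensor q G (conjugate G g g1) (conjugate G g h)
        \<otimes>\<^bsub>q_tensor_square q G\<^esub> q_tensor q G g h"
      if "g \<in> carrier G" "g1 \<in> carrier G" "h \<in> carrier G" for g g1 h
      using rel[OF q_tensor_rels.tensor_mult_left, of g g1 h] that
      by (simp add: q_tensor_def q_tensor_square_def presented_group_mult symbs_def)
    show "q_tensor q G g (h \<otimes> h1) = q_tensor q G g h
        \<otimes>\<^bsub>q_tensor_square q G\<^esub> q_tensor q G (conjugate G h g) (conjugate G h h1)"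
      if "g \<in> carrier G" "h \<in> carrier G" "h1 \<in> carrier G" for g h h1
      using rel[OF q_tensor_rels.tensor_mult_right, of g h h1] that
      by (simp add: q_tensor_def q_tensor_square_def presented_group_mult symbs_def)
  qed
qed


text \<open>
  A generator \<open>{(k,k)}\<close> acts on tensors as conjugation by \<open>k\<^sup>q\<close>, under which \<open>g \<otimes> g\<close> is invariant.
\<close>

lemma diagonal_central:
  assumes g: "g \<in> carrier G" and c: "c \<in> carrier (q_tensor_square q G)"
  shows "q_tensor q G g g \<otimes>\<^bsub>q_tensor_square q G\<^esub> c
    = c \<otimes>\<^bsub>q_tensor_square q G\<^esub> q_tensor q G g g"
proof -
  let ?X = "symbs G" and ?R = "q_tensor_rels q G" and ?T = "q_tensor_square q G"
  interpret t: crossed_pairing G ?T "q_tensor q G" by (rule crossed_pairing_q_tensor)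
  have X: "Tensor g h \<in> ?X" "Diag g \<in> ?X" if "g \<in> carrier G" "h \<in> carrier G" for g h
    using that by (auto simp: symbs_def)
  note mult = presented_group_mult[of _ ?X _ ?R, folded q_tensor_square_def]
  show ?thesis
    unfolding q_tensor_square_def
  proof (rule presented_group_centralI)
    show "q_tensor q G g g \<in> carrier (presented_group ?X ?R)"
      using g t.closed[of g g] by (simp add: q_tensor_square_def)
    show "c \<in> carrier (presented_group ?X ?R)"
      using c by (simp add: q_tensor_square_def)
    fix x assume "x \<in> ?X"
    then consider (Tensor) h k where "x = Tensor h k" "h \<in> carrier G" "k \<in> carrier G"
      | (Diag) k where "x = Diag k" "k \<in> carrier G"
      by (auto simp: symbs_def)
    then have "q_tensor q G g g \<otimes>\<^bsub>?T\<^esub> pres_class ?X ?R [(x, True)]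
      = pres_class ?X ?R [(x, True)] \<otimes>\<^bsub>?T\<^esub> q_tensor q G g g"
    proof cases
      case Tensor
      then show ?thesis
        using t.diagonal_commute[of g h k] g by (simp add: q_tensor_def)
    next
      case (Diag k)
      let ?w = "word_inv (diag k)"
      have "q_tensor q G g g
          = q_tensor q G (conjugate G (k [^] q) g) (conjugate G (k [^] q) g)"
        using t.diagonal_conjugate[of g "k [^] q"] g Diag by simp
      also have "\<dots> = pres_class ?X ?R (diag k @ tens g g @ ?w)"
        using pres_eq.sym[OF pres_eq.rel[OF q_tensor_rels.diag_conj[of k G g g q], of ?X "[]" "[]"]] g Diag X
        by (simp add: q_tensor_def pres_class_eq_iff)
      finally have "q_tensor q G g g \<otimes>\<^bsub>?T\<^esub> pres_class ?X ?R (diag k)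
          = pres_class ?X ?R ((diag k @ tens g g) @ ?w @ diag k)"
        using g Diag X by (simp add: mult)
      also have "\<dots> = pres_class ?X ?R ((diag k @ tens g g) @ [])"
        using g Diag X pres_eq_append[OF pres_eq.refl pres_eq_word_inv,
            of "diag k @ tens g g" ?X "diag k" ?R]
        by (simp add: pres_class_eq_iff)
      also have "\<dots> = pres_class ?X ?R (diag k) \<otimes>\<^bsub>?T\<^esub> q_tensor q G g g"
        using g Diag X by (simp add: q_tensor_def mult)
      finally show ?thesis using Diag by simp
    qed
    then show "q_tensor q G g g \<otimes>\<^bsub>presented_group ?X ?R\<^esub> pres_class ?X ?R [(x, True)]
      = pres_class ?X ?R [(x, True)] \<otimes>\<^bsub>presented_group ?X ?R\<^esub> q_tensor q G g g"
      by (simp add: q_tensor_square_def)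
  qed
qed

text \<open>
  The relation for \<open>{(1 1, 1 1)}\<close> reads \<open>d = d d\<close>, because its middle factors are all \<open>1 \<otimes> 1 = 1\<close>.
\<close>

lemma diag_one:
  "pres_class (symbs G) (q_tensor_rels q G) (diag \<one>) = \<one>\<^bsub>q_tensor_square q G\<^esub>"
proof -
  let ?X = "symbs G" and ?R = "q_tensor_rels q G" and ?T = "q_tensor_square q G"
  interpret t: crossed_pairing G ?T "q_tensor q G" by (rule crossed_pairing_q_tensor)
  note mult = presented_group_mult[of _ ?X _ ?R, folded q_tensor_square_def]
  have X [simp]: "Tensor \<one> \<one> \<in> ?X" "Diag \<one> \<in> ?X" by (auto simp: symbs_def)
  have carrier: "pres_class ?X ?R (diag \<one>) \<in> carrier ?T"
    by (auto simp: q_tensor_square_def presented_group_carrier)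
  have words: "concat (map (\<lambda>i. tens \<one> \<one>) l) \<in> words ?X" for l :: "nat list"
    by (induction l) simp_all
  have ones: "pres_class ?X ?R (concat (map (\<lambda>i. tens \<one> \<one>) l)) = \<one>\<^bsub>?T\<^esub>" for l :: "nat list"
  proof (induction l)
    case Nil
    then show ?case by (simp add: q_tensor_square_def presented_group_one)
  next
    case (Cons i l)
    then show ?case
      using t.one_one words[of l] mult[of "tens \<one> \<one>" "concat (map (\<lambda>i. tens \<one> \<one>) l)"]
      by (simp add: q_tensor_def)
  qed
  have "(diag \<one>, diag \<one> @ concat (map (\<lambda>i. tens \<one> \<one>) [1..<q]) @ diag \<one>) \<in> ?R"
    using q_tensor_rels.diag_mult[of \<one> G \<one> q] by simp
  then have "pres_class ?X ?R (diag \<one>)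
      = pres_class ?X ?R (diag \<one> @ concat (map (\<lambda>i. tens \<one> \<one>) [1..<q]) @ diag \<one>)"
    using pres_eq.rel[of _ _ ?R ?X "[]" "[]"] words[of "[1..<q]"] by (simp add: pres_class_eq_iff)
  also have "\<dots> = pres_class ?X ?R (diag \<one>) \<otimes>\<^bsub>?T\<^esub>
      (pres_class ?X ?R (concat (map (\<lambda>i. tens \<one> \<one>) [1..<q])) \<otimes>\<^bsub>?T\<^esub> pres_class ?X ?R (diag \<one>))"
    using words[of "[1..<q]"] by (simp add: mult)
  also have "\<dots> = pres_class ?X ?R (diag \<one>) \<otimes>\<^bsub>?T\<^esub> pres_class ?X ?R (diag \<one>)"
    using carrier by (subst ones) simp
  finally show ?thesis using carrier by simp
qed

text \<open>
  By the relation for commutators, \<open>(g \<otimes> g)\<^sup>q\<close> is \<open>{(c,c)}\<close> for the commutator \<open>c = [g,g] = 1\<close>.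
\<close>

lemma diagonal_exponent:
  assumes g: "g \<in> carrier G"
  shows "q_tensor q G g g [^]\<^bsub>q_tensor_square q G\<^esub> q = \<one>\<^bsub>q_tensor_square q G\<^esub>"
proof -
  let ?X = "symbs G" and ?R = "q_tensor_rels q G" and ?T = "q_tensor_square q G"
  interpret T: group ?T by (rule group_q_tensor_square)
  note mult = presented_group_mult[of _ ?X _ ?R, folded q_tensor_square_def]
  have X [simp]: "Tensor g g \<in> ?X" "Diag \<one> \<in> ?X" using g by (auto simp: symbs_def)
  have carrier: "q_tensor q G g g \<in> carrier ?T"
    by (auto simp: q_tensor_def q_tensor_square_def presented_group_carrier)
  have words: "concat (replicate n (tens g g)) \<in> words ?X" for n
    by (induction n) simp_all
  have "pres_class ?X ?R (concat (replicate n (tens g g))) = q_tensor q G g g [^]\<^bsub>?T\<^esub> n" for n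
  proof (induction n)
    case 0
    then show ?case by (simp add: q_tensor_square_def presented_group_one)
  next
    case (Suc n)
    have "pres_class ?X ?R (concat (replicate (Suc n) (tens g g)))
        = q_tensor q G g g \<otimes>\<^bsub>?T\<^esub> pres_class ?X ?R (concat (replicate n (tens g g)))"
      using words[of n] mult[of "tens g g" "concat (replicate n (tens g g))"]
      by (simp add: q_tensor_def)
    then show ?case by (simp only: Suc.IH T.nat_pow_Suc2[OF carrier])
  qed
  moreover have "pres_class ?X ?R (concat (replicate q (tens g g))) = pres_class ?X ?R (diag \<one>)"
  proof -
    have "commutator G g g = \<one>" using g by (simp add: commutator_def m_assoc)
    then have "(diag \<one>, concat (replicate q (tens g g))) \<in> ?R"
      using q_tensor_rels.commutator_diag[OF g g, of q] by simp
    then show ?thesis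
      using pres_eq.sym[OF pres_eq.rel[of _ _ ?R ?X "[]" "[]"]] words[of q]
      by (simp add: pres_class_eq_iff)
  qed
  ultimately show ?thesis by (simp add: diag_one)
qed

text \<open>
  A subgroup of the center is normal, hence one of those whose intersection is the normal closure.
\<close>

lemma normal_closure_subset_central:
  assumes H: "subgroup H G" and "S \<subseteq> H"
    and central: "\<And>h g. h \<in> H \<Longrightarrow> g \<in> carrier G \<Longrightarrow> h \<otimes> g = g \<otimes> h"
  shows "normal_closure G S \<subseteq> H"
proof -
  have "g \<otimes> h \<otimes> inv g \<in> H" if "h \<in> H" "g \<in> carrier G" for g h
    using that subgroup.mem_carrier[OF H that(1)]
    by (subst central[OF that, symmetric]) (simp add: m_assoc)
  then have "H \<lhd> G" using H by (simp add: normal_inv_iff)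
  then show ?thesis using assms(2) by (auto simp: normal_closure_def)
qed

lemma nabla_central_exponent:
  assumes "z \<in> nabla q G"
  shows "\<forall>c \<in> carrier (q_tensor_square q G).
      z \<otimes>\<^bsub>q_tensor_square q G\<^esub> c = c \<otimes>\<^bsub>q_tensor_square q G\<^esub> z"
    and "z [^]\<^bsub>q_tensor_square q G\<^esub> q = \<one>\<^bsub>q_tensor_square q G\<^esub>"
proof -
  let ?T = "q_tensor_square q G"
  interpret t: crossed_pairing G ?T "q_tensor q G" by (rule crossed_pairing_q_tensor)
  define Z where "Z = {z \<in> carrier ?T. (\<forall>c \<in> carrier ?T. z \<otimes>\<^bsub>?T\<^esub> c = c \<otimes>\<^bsub>?T\<^esub> z)
    \<and> z [^]\<^bsub>?T\<^esub> q = \<one>\<^bsub>?T\<^esub>}"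
  have Z: "z \<in> carrier ?T" "z [^]\<^bsub>?T\<^esub> q = \<one>\<^bsub>?T\<^esub>" if "z \<in> Z" for z
    using that by (auto simp: Z_def)
  have commute: "z \<otimes>\<^bsub>?T\<^esub> c = c \<otimes>\<^bsub>?T\<^esub> z" if "z \<in> Z" "c \<in> carrier ?T" for z c
    using that unfolding Z_def by blast
  have ZI: "z \<in> Z" if "z \<in> carrier ?T" "z [^]\<^bsub>?T\<^esub> q = \<one>\<^bsub>?T\<^esub>"
    "\<And>c. c \<in> carrier ?T \<Longrightarrow> z \<otimes>\<^bsub>?T\<^esub> c = c \<otimes>\<^bsub>?T\<^esub> z" for z
    using that unfolding Z_def by blast
  have "subgroup Z ?T"
  proof (rule t.T.subgroupI)
    have "\<one>\<^bsub>?T\<^esub> \<in> Z" by (rule ZI) simp_all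
    then show "Z \<noteq> {}" by blast
    show "Z \<subseteq> carrier ?T" using Z by blast
    fix a assume a: "a \<in> Z"
    show "inv\<^bsub>?T\<^esub> a \<in> Z"
    proof (rule ZI)
      show "inv\<^bsub>?T\<^esub> a \<in> carrier ?T" using a Z by simp
      show "(inv\<^bsub>?T\<^esub> a) [^]\<^bsub>?T\<^esub> q = \<one>\<^bsub>?T\<^esub>"
        using a Z by (simp add: t.T.nat_pow_inv)
      show "inv\<^bsub>?T\<^esub> a \<otimes>\<^bsub>?T\<^esub> c = c \<otimes>\<^bsub>?T\<^esub> inv\<^bsub>?T\<^esub> a" if "c \<in> carrier ?T" for c
        using commute[OF a that] Z(1)[OF a] that by (rule t.T.inv_commute)
    qed
    fix b assume b: "b \<in> Z"
    show "a \<otimes>\<^bsub>?T\<^esub> b \<in> Z"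
    proof (rule ZI)
      show "a \<otimes>\<^bsub>?T\<^esub> b \<in> carrier ?T" using a b Z by simp
      show "(a \<otimes>\<^bsub>?T\<^esub> b) [^]\<^bsub>?T\<^esub> q = \<one>\<^bsub>?T\<^esub>"
        using a b Z commute[of a b] by (simp add: t.T.pow_mult_distrib)
      show "a \<otimes>\<^bsub>?T\<^esub> b \<otimes>\<^bsub>?T\<^esub> c = c \<otimes>\<^bsub>?T\<^esub> (a \<otimes>\<^bsub>?T\<^esub> b)" if "c \<in> carrier ?T" for c
        using that Z(1)[OF a] Z(1)[OF b] commute[OF a that] commute[OF b that]
        by (metis t.T.m_assoc)
    qed
  qed
  then have "nabla q G \<subseteq> Z"
    unfolding nabla_def
  proof (rule t.T.normal_closure_subset_central)
    show "{q_tensor q G g g |g. g \<in> carrier G} \<subseteq> Z"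
      by (auto intro!: ZI diagonal_central diagonal_exponent)
  qed (rule commute)
  then show "\<forall>c \<in> carrier ?T. z \<otimes>\<^bsub>?T\<^esub> c = c \<otimes>\<^bsub>?T\<^esub> z" "z [^]\<^bsub>?T\<^esub> q = \<one>\<^bsub>?T\<^esub>"
    using assms Z commute by blast+
qed

section \<open>The retraction onto the diagonal part\<close>

text \<open>
  Injectivity: elements with the same coset differ by some \<open>n\<close> in \<open>N\<close>, and \<open>\<rho>\<close> detects \<open>n\<close>.
  Surjectivity: within a coset \<open>N x\<close>, left multiplication by elements of \<open>N\<close> adjusts \<open>\<rho> x\<close> to any
  prescribed value.
\<close>

lemma retract_is_direct_factor:
  assumes N: "N \<lhd> G" and \<rho>: "\<rho> \<in> hom G (G\<lparr>carrier := N\<rparr>)"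
    and fixed: "\<And>n. n \<in> N \<Longrightarrow> \<rho> n = n"
  shows "G \<cong> G\<lparr>carrier := N\<rparr> \<times>\<times> (G Mod N)"
proof (rule is_isoI, rule isoI)
  interpret N: normal N G by fact
  let ?\<Phi> = "\<lambda>x. (\<rho> x, N #> x)"
  have closed: "\<rho> x \<in> N" if "x \<in> carrier G" for x
    using \<rho> that by (auto simp: hom_def)
  have mult: "\<rho> (x \<otimes> y) = \<rho> x \<otimes> \<rho> y" if "x \<in> carrier G" "y \<in> carrier G" for x y
    using \<rho> that by (auto simp: hom_def)
  show "?\<Phi> \<in> hom G (G\<lparr>carrier := N\<rparr> \<times>\<times> (G Mod N))"
    using \<rho> N.r_coset_hom_Mod by (auto simp: hom_def)
  show "bij_betw ?\<Phi> (carrier G) (carrier (G\<lparr>carrier := N\<rparr> \<times>\<times> (G Mod N)))"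
  proof (rule bij_betw_imageI)
    show "inj_on ?\<Phi> (carrier G)"
    proof (rule inj_onI)
      fix x y assume xy: "x \<in> carrier G" "y \<in> carrier G" "?\<Phi> x = ?\<Phi> y"
      then have "x \<in> N #> y" using rcos_self[OF xy(1) N.subgroup_axioms] by simp
      then obtain n where n: "n \<in> N" "x = n \<otimes> y" by (auto simp: r_coset_def)
      then have "\<rho> y = n \<otimes> \<rho> y"
        using xy mult[of n y] fixed by auto
      then show "x = y" using n xy closed by simp
    qed
    show "?\<Phi> ` carrier G = carrier (G\<lparr>carrier := N\<rparr> \<times>\<times> (G Mod N))"
    proof
      show "?\<Phi> ` carrier G \<subseteq> carrier (G\<lparr>carrier := N\<rparr> \<times>\<times> (G Mod N))"
        using closed by (auto simp: carrier_FactGroup)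
      show "carrier (G\<lparr>carrier := N\<rparr> \<times>\<times> (G Mod N)) \<subseteq> ?\<Phi> ` carrier G"
      proof
        fix p assume "p \<in> carrier (G\<lparr>carrier := N\<rparr> \<times>\<times> (G Mod N))"
        then obtain n x where p: "p = (n, N #> x)" "n \<in> N" "x \<in> carrier G"
          by (auto simp: carrier_FactGroup)
        define m where "m = n \<otimes> inv (\<rho> x)"
        have m: "m \<in> N" using p closed by (simp add: m_def)
        have "\<rho> (m \<otimes> x) = n"
          using p m closed[OF p(3)] by (simp add: mult fixed) (simp add: m_def m_assoc)
        moreover have "N #> (m \<otimes> x) = N #> x"
          using m p by (simp add: coset_mult_assoc[symmetric] N.subset N.rcos_const)
        ultimately show "p \<in> ?\<Phi> ` carrier G"
          using p m by (auto intro!: image_eqI[of _ _ "m \<otimes> x"])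
      qed
    qed
  qed
qed

lemma nabla_retraction:
  assumes q: "odd q"
  obtains \<rho> where "\<rho> \<in> hom (q_tensor_square q G) (nabla_group q G)"
    and "\<And>z. z \<in> nabla q G \<Longrightarrow> \<rho> z = z"
proof -
  let ?T = "q_tensor_square q G" and ?N = "nabla q G"
  interpret t: crossed_pairing G ?T "q_tensor q G" by (rule crossed_pairing_q_tensor)
  interpret N: normal ?N ?T by (rule nabla_normal)
  note central = nabla_central_exponent(1)[where q = q, THEN bspec]
  have diagonal: "q_tensor q G g g \<in> ?N" if "g \<in> carrier G" for g
    using that by (auto simp: nabla_def normal_closure_def)
  have K: "comm_group (nabla_group q G)"
    unfolding nabla_group_def
    by (rule group.group_comm_groupI[OF t.T.subgroup_imp_group[OF N.subgroup_axioms]])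
      (simp, rule central, simp_all)
  have pow: "x [^]\<^bsub>nabla_group q G\<^esub> n = x [^]\<^bsub>?T\<^esub> n" for x and n :: nat
    unfolding nabla_group_def by (rule t.T.nat_pow_consistent[symmetric])
  have sym: "t.sym g h \<in> ?N" if "g \<in> carrier G" "h \<in> carrier G" for g h
  proof -
    let ?d = "q_tensor q G g g \<otimes>\<^bsub>?T\<^esub> q_tensor q G h h"
    have "t.sym g h = inv\<^bsub>?T\<^esub> ?d \<otimes>\<^bsub>?T\<^esub> q_tensor q G (g \<otimes> h) (g \<otimes> h)"
      using that t.polarization[of g h] t.T.inv_solve_left[of "t.sym g h" ?d] by simp
    then show ?thesis using that diagonal by simp
  qed
  \<comment> \<open>raising to the power \<open>m\<close> is the square root on the exponent-\<open>q\<close> group \<open>nabla q G\<close>, as \<open>2 m = q + 1\<close>\<close>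
  define m where "m = (q + 1) div 2"
  have m: "2 * m = q + 1" using q by (simp add: m_def)
  define b where "b g h = t.sym g h [^]\<^bsub>?T\<^esub> m" for g h
  have pow_N: "x [^]\<^bsub>?T\<^esub> n \<in> ?N" if "x \<in> ?N" for x and n :: nat
    using that by (induction n) auto
  have b: "b g h \<in> ?N" if "g \<in> carrier G" "h \<in> carrier G" for g h
    unfolding b_def using sym[OF that] by (rule pow_N)
  have b_mult: "(x \<otimes>\<^bsub>?T\<^esub> y) [^]\<^bsub>?T\<^esub> m = x [^]\<^bsub>?T\<^esub> m \<otimes>\<^bsub>?T\<^esub> y [^]\<^bsub>?T\<^esub> m"
    if "x \<in> ?N" "y \<in> ?N" for x y
    using that by (intro t.T.pow_mult_distrib central) simp_all
  have left: "(\<lambda>g. b g h) \<in> hom G (nabla_group q G)" if "h \<in> carrier G" for h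
    by (rule homI) (simp_all add: that b nabla_group_def,
      simp add: that b_def t.sym_mult_left b_mult sym)
  have right: "(\<lambda>h. b g h) \<in> hom G (nabla_group q G)" if "g \<in> carrier G" for g
    by (rule homI) (simp_all add: that b nabla_group_def,
      simp add: that b_def t.sym_mult_right b_mult sym)
  have exponent: "b g h [^]\<^bsub>nabla_group q G\<^esub> q = \<one>\<^bsub>nabla_group q G\<^esub>"
    if "g \<in> carrier G" "h \<in> carrier G" for g h
    using nabla_central_exponent(2)[OF b[OF that]] by (simp add: pow) (simp add: nabla_group_def)
  from bimultiplicative_extends_to_q_tensor_square[OF K q left right exponent] obtain \<rho>
    where hom: "\<rho> \<in> hom ?T (nabla_group q G)"
      and \<rho>: "\<And>g h. g \<in> carrier G \<Longrightarrow> h \<in> carrier G \<Longrightarrow> \<rho> (q_tensor q G g h) = b g h"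
    by blast
  have b_diagonal: "b g g = q_tensor q G g g" if "g \<in> carrier G" for g
  proof -
    let ?z = "q_tensor q G g g"
    have z: "?z \<in> carrier ?T" using that by simp
    have "b g g = (?z [^]\<^bsub>?T\<^esub> (2 :: nat)) [^]\<^bsub>?T\<^esub> m"
      using z by (simp add: b_def t.sym_def numeral_2_eq_2)
    also have "\<dots> = ?z [^]\<^bsub>?T\<^esub> (q + 1)"
      using z by (simp only: t.T.nat_pow_pow m)
    also have "\<dots> = ?z" using z diagonal_exponent[OF that, of q] by simp
    finally show ?thesis .
  qed
  interpret \<rho>: group_hom ?T "nabla_group q G" \<rho>
    by (intro group_hom.intro group_hom_axioms.intro t.T.is_group hom comm_group.axioms(2)[OF K])
  \<comment> \<open>the fixed points form a central subgroup containing the squares, hence all of \<open>nabla q G\<close>\<close>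
  have "subgroup {z \<in> ?N. \<rho> z = z} ?T"
  proof (rule t.T.subgroupI)
    have "\<rho> \<one>\<^bsub>?T\<^esub> = \<one>\<^bsub>?T\<^esub>" using \<rho>.hom_one by (simp add: nabla_group_def)
    then have "\<one>\<^bsub>?T\<^esub> \<in> {z \<in> ?N. \<rho> z = z}" by simp
    then show "{z \<in> ?N. \<rho> z = z} \<noteq> {}" by blast
    fix a assume a: "a \<in> {z \<in> ?N. \<rho> z = z}"
    have "\<rho> (inv\<^bsub>?T\<^esub> a) = inv\<^bsub>nabla_group q G\<^esub> a" using a by simp
    also have "\<dots> = inv\<^bsub>?T\<^esub> a"
      unfolding nabla_group_def using a by (simp add: t.T.m_inv_consistent[OF N.subgroup_axioms])
    finally show "inv\<^bsub>?T\<^esub> a \<in> {z \<in> ?N. \<rho> z = z}" using a by simp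
    fix c assume c: "c \<in> {z \<in> ?N. \<rho> z = z}"
    have "\<rho> (a \<otimes>\<^bsub>?T\<^esub> c) = a \<otimes>\<^bsub>nabla_group q G\<^esub> c" using a c by simp
    then show "a \<otimes>\<^bsub>?T\<^esub> c \<in> {z \<in> ?N. \<rho> z = z}" using a c by (simp add: nabla_group_def)
  qed auto
  then have "?N \<subseteq> {z \<in> ?N. \<rho> z = z}"
    unfolding nabla_def
  proof (rule t.T.normal_closure_subset_central, fold nabla_def)
    show "{q_tensor q G g g |g. g \<in> carrier G} \<subseteq> {z \<in> ?N. \<rho> z = z}"
      using diagonal \<rho> b_diagonal by auto
  qed (rule central, simp_all)
  then show ?thesis using that[OF hom] by blast
qed

end

theorem corollary5p3:
  fixes G :: "('a, 'b) monoid_scheme" and q :: nat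
  assumes "group G" and "odd q"
  shows "q_tensor_square q G \<cong> nabla_group q G \<times>\<times> q_exterior_square q G"
proof -
  interpret group G by fact
  interpret T: group "q_tensor_square q G" by (rule group_q_tensor_square)
  obtain \<rho> where "\<rho> \<in> hom (q_tensor_square q G) (nabla_group q G)"
    and "\<And>z. z \<in> nabla q G \<Longrightarrow> \<rho> z = z"
    using nabla_retraction[OF assms(2)] by blast
  then show ?thesis
    unfolding nabla_group_def q_exterior_square_def
    by (rule T.retract_is_direct_factor[OF nabla_normal])
qed

end
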